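(* Fix $m,p\in\mathbb{N}$ and let $a_n=\lfloor n\phi_{mp}/p\rfloor$ and $b_n=\lfloor n(\phi_{mp}+mp)/p\rfloor$ for $n\in\mathbb{N}_0$, where $\phi_k=\frac{2-k+\sqrt{k^2+4}}{2}$. For $n\in\mathbb{N}_0$ define $\varphi_n=\frac{a_n+(mp-1)b_n}{m}$. Then for each $n\in\mathbb{N}$, $\varphi_n$ is the greatest integer $k$ such that $a_k=b_n-1$.
   Context: $\mathbb{N}=\{1,2,\dots\}$, $\mathbb{N}_0=\{0,1,2,\dots\}$. *)

theory Defs
  imports Complex_Main
begin

definition phi :: "nat \<Rightarrow> real" where
  "phi k = (2 - real k + sqrt ((real k)\<^sup>2 + 4)) / 2"

definition a_seq :: "nat \<Rightarrow> nat \<Rightarrow> nat \<Rightarrow> int" where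
  "a_seq m p n = \<lfloor>real n * phi (m * p) / real p\<rfloor>"

definition b_seq :: "nat \<Rightarrow> nat \<Rightarrow> nat \<Rightarrow> int" where
  "b_seq m p n = \<lfloor>real n * (phi (m * p) + real (m * p)) / real p\<rfloor>"

(* Real-valued with genuine division by m: that the quotient is an integer
   is not built into the definition. *)
definition varphi :: "nat \<Rightarrow> nat \<Rightarrow> nat \<Rightarrow> real" where
  "varphi m p n =
     (real_of_int (a_seq m p n) + (real (m * p) - 1) * real_of_int (b_seq m p n)) / real m"

end

theory Submission
  imports Defs
begin

text \<open>
  Put $K = mp$, $\phi = \phi_K$, $\alpha = \phi/p$, and let $f$ be the fractional part of $n\alpha$.
  Since $b_n = a_n + mn$, we have $\varphi_n = p a_n + (K-1)n$, an integer $k$, and the quadratic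
  equation of $\phi$ gives $k\alpha = b_n - (\phi-1)f$. Here $f > 0$ because $\phi$ is irrational,
  and $0 < \phi - 1 < 1/K$; so $k\alpha$ lies strictly between $b_n - 1$ and $b_n$, while
  $(k+1)\alpha$ exceeds $b_n$.
\<close>

lemma phi_quadratic: "phi K * phi K = real K + (2 - real K) * phi K"
proof -
  define x where "x = sqrt ((real K)\<^sup>2 + 4)"
  have "x * x = (real K)\<^sup>2 + 4" by (simp add: x_def)
  then show ?thesis
    unfolding phi_def x_def[symmetric] by (simp add: field_simps power2_eq_square)
qed

lemma phi_gt_1: "phi K > 1"
proof -
  have "sqrt ((real K)\<^sup>2 + 4) > real K" by (rule real_less_rsqrt) simp
  then show ?thesis by (simp add: phi_def)
qed

text \<open>In terms of y = \<open>phi K - 1\<close> the quadratic equation reads y^2 + K y = 1, and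
  y^2 is positive.\<close>

lemma phi_minus_1_bound:
  assumes "K \<ge> 1"
  shows "real K * (phi K - 1) < 1"
proof -
  have "(phi K - 1) * (phi K - 1) + real K * (phi K - 1) = 1"
    using phi_quadratic[of K] by (simp add: algebra_simps)
  moreover have "(phi K - 1) * (phi K - 1) > 0" using phi_gt_1[of K] by simp
  ultimately show ?thesis by linarith
qed

text \<open>The only square strictly between K^2 and (K + 2)^2 is (K + 1)^2, and it differs from K^2
  by an odd number.\<close>

lemma square_plus_4_not_square:
  fixes K s :: int
  assumes "K \<ge> 1" "s \<ge> 0"
  shows "s\<^sup>2 \<noteq> K\<^sup>2 + 4"
proof
  assume eq: "s\<^sup>2 = K\<^sup>2 + 4"
  consider "s \<le> K" | "s = K + 1" | "s \<ge> K + 2" by linarith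
  then show False
  proof cases
    case 1
    then have "s\<^sup>2 \<le> K\<^sup>2" using assms by (intro power_mono) auto
    with eq show False by simp
  next
    case 2
    with eq have "2 * K = 3" by (simp add: power2_eq_square algebra_simps)
    then show False by presburger
  next
    case 3
    then have "(K + 2)\<^sup>2 \<le> s\<^sup>2" using assms by (intro power_mono) auto
    with eq assms show False by (simp add: power2_eq_square algebra_simps)
  qed
qed

text \<open>This is the irrationality of \<open>phi K\<close> in the form needed for
  \<open>f\<close> to be nonzero: otherwise n sqrt(K^2 + 4) would be an integer, making K^2 + 4 a
  square.\<close>

lemma multiple_phi_not_int:
  assumes "K \<ge> 1" "n \<ge> 1"
  shows "real n * phi K \<noteq> of_int z"
proof
  assume eq: "real n * phi K = of_int z"
  define x where "x = sqrt ((real K)\<^sup>2 + 4)"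
  define t where "t = 2 * z - int n * (2 - int K)"
  have "real n * x = of_int t"
    using eq unfolding phi_def x_def[symmetric] t_def by (simp add: field_simps)
  then have "(of_int t)\<^sup>2 = (real n)\<^sup>2 * ((real K)\<^sup>2 + 4)"
    by (simp add: x_def power_mult_distrib flip: \<open>real n * x = of_int t\<close>)
  then have "real_of_int (t\<^sup>2) = real_of_int ((int n)\<^sup>2 * ((int K)\<^sup>2 + 4))" by simp
  then have t2: "t\<^sup>2 = (int n)\<^sup>2 * ((int K)\<^sup>2 + 4)" by (simp only: of_int_eq_iff)
  then have "(int n)\<^sup>2 dvd t\<^sup>2" by simp
  then have "int n dvd t" by simp
  then obtain s where "t = int n * s" by (elim dvdE)
  \<comment> \<open>Cancel n^2; the absolute value provides the nonnegative root that
    \<open>square_plus_4_not_square\<close> asks for.\<close>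
  with t2 assms have "\<bar>s\<bar>\<^sup>2 = (int K)\<^sup>2 + 4" by (simp add: power_mult_distrib)
  with square_plus_4_not_square[of "int K" "\<bar>s\<bar>"] assms show False by simp
qed

text \<open>The extra summand n (m p) / p is the integer m n, so it can be pulled out of the
  floor.\<close>

lemma b_seq_eq:
  assumes "p \<ge> 1"
  shows "b_seq m p n = a_seq m p n + int (m * n)"
proof -
  have "real n * (phi (m * p) + real (m * p)) / real p =
      real n * phi (m * p) / real p + of_int (int (m * n))"
    using assms by (simp add: field_simps)
  then show ?thesis unfolding a_seq_def b_seq_def by (simp only: floor_add_int)
qed

theorem theorem5p1:
  fixes m p n :: nat
  assumes "m \<ge> 1" and "p \<ge> 1" and "n \<ge> 1"
  shows "\<exists>k::nat. varphi m p n = real k \<and>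
           a_seq m p k = b_seq m p n - 1 \<and>
           (\<forall>j::nat. a_seq m p j = b_seq m p n - 1 \<longrightarrow> j \<le> k)"
proof -
  define K where "K = m * p"
  define \<alpha> where "\<alpha> = phi K / real p"
  define f where "f = real n * \<alpha> - of_int (a_seq m p n)"
  \<comment> \<open>Neither \<open>nat\<close> nor the natural subtraction truncates here, since a_n
    \<ge> 0 and K \<ge> 1.\<close>
  define k where "k = p * nat (a_seq m p n) + (K - 1) * n"
  have K1: "K \<ge> 1" and Kp: "p \<le> K" using assms by (auto simp: K_def)
  have a_floor: "a_seq m p j = \<lfloor>real j * \<alpha>\<rfloor>" for j
    by (simp add: a_seq_def \<alpha>_def K_def)
  have \<phi>1: "phi K > 1" by (rule phi_gt_1)
  have \<alpha>_pos: "\<alpha> > 0" using \<phi>1 assms by (simp add: \<alpha>_def)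
  have a_nonneg: "a_seq m p n \<ge> 0" using \<alpha>_pos by (simp add: a_floor)
  have f0: "f > 0"
  proof -
    have "f \<noteq> 0"
    proof
      assume "f = 0"
      then have "real n * phi K = of_int (a_seq m p n * int p)"
        using assms by (simp add: f_def \<alpha>_def field_simps)
      with multiple_phi_not_int[OF K1 assms(3)] show False by blast
    qed
    moreover have "f \<ge> 0" by (simp add: f_def a_floor)
    ultimately show ?thesis by simp
  qed
  have f1: "f < 1" unfolding f_def a_floor by linarith
  have real_k: "real k = real p * of_int (a_seq m p n) + (real K - 1) * real n"
    using a_nonneg K1 by (simp add: k_def of_nat_diff)
  have b: "b_seq m p n = a_seq m p n + int (m * n)" by (rule b_seq_eq[OF assms(2)])
  have "varphi m p n = real k"
    using assms by (simp add: varphi_def b real_k K_def field_simps)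
  have p\<alpha>: "real p * \<alpha> = phi K" using assms by (simp add: \<alpha>_def)
  have k\<alpha>: "real k * \<alpha> = of_int (b_seq m p n) - (phi K - 1) * f"
  proof -
    \<comment> \<open>This is the quadratic equation in the form phi^2 + (K - 1) phi = phi + K,
      divided by p, with K / p = m.\<close>
    have "\<alpha> * phi K + (real K - 1) * \<alpha> = \<alpha> + real m"
    proof -
      have "\<alpha> * phi K + (real K - 1) * \<alpha> = (phi K * phi K + (real K - 1) * phi K) / real p"
        by (simp add: \<alpha>_def add_divide_distrib)
      also have "\<dots> = (phi K + real K) / real p"
        by (simp add: phi_quadratic algebra_simps)
      also have "\<dots> = \<alpha> + real m"
        using assms by (simp add: \<alpha>_def K_def add_divide_distrib)
      finally show ?thesis .
    qed
    then have *: "real n * (\<alpha> * phi K + (real K - 1) * \<alpha>) = real n * (\<alpha> + real m)" by simp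
    have "real k * \<alpha> = (real p * \<alpha>) * of_int (a_seq m p n) + (real K - 1) * real n * \<alpha>"
      by (simp add: real_k algebra_simps)
    \<comment> \<open>Substitute a_n = n \<alpha> - f.\<close>
    also have "\<dots> = real n * (\<alpha> * phi K + (real K - 1) * \<alpha>) - phi K * f"
      unfolding p\<alpha> f_def by (simp add: algebra_simps)
    \<comment> \<open>Here n (\<alpha> + m) = a_n + f + m n = b_n + f.\<close>
    also have "\<dots> = of_int (b_seq m p n) - (phi K - 1) * f"
      unfolding * b f_def by (simp add: algebra_simps)
    finally show ?thesis .
  qed
  have gap0: "(phi K - 1) * f > 0" using \<phi>1 f0 by simp
  have gap_lt: "(phi K - 1) * f < phi K - 1" using \<phi>1 f1 by simp
  have gap_p: "real p * (phi K - 1) < 1"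
  proof -
    have "real p * (phi K - 1) \<le> real K * (phi K - 1)"
      using Kp \<phi>1 by (intro mult_right_mono) auto
    with phi_minus_1_bound[OF K1] show ?thesis by linarith
  qed
  have gap_1: "phi K - 1 < 1"
  proof -
    have "1 * (phi K - 1) \<le> real p * (phi K - 1)"
      using assms \<phi>1 by (intro mult_right_mono) auto
    also note gap_p
    finally show ?thesis by simp
  qed
  \<comment> \<open>After scaling by p, the left side is below 1 and the right side is
    \<open>phi K\<close> > 1. Hence one more \<alpha> outweighs the gap between k \<alpha> and
    b_n.\<close>
  have "phi K - 1 < \<alpha>"
  proof -
    have "real p * (phi K - 1) < real p * \<alpha>" using gap_p \<phi>1 p\<alpha> by linarith
    then show ?thesis using assms by simp
  qed
  with k\<alpha> gap_lt have next_gt: "real (Suc k) * \<alpha> > of_int (b_seq m p n)"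
    by (simp add: algebra_simps)
  have "a_seq m p k = b_seq m p n - 1"
    unfolding a_floor k\<alpha> using gap0 gap_lt gap_1 by (intro floor_unique) auto
  moreover have "j \<le> k" if "a_seq m p j = b_seq m p n - 1" for j
  proof (rule ccontr)
    assume "\<not> j \<le> k"
    \<comment> \<open>As \<alpha> > 0, every j beyond k has j \<alpha> > b_n, so its floor is at
      least b_n.\<close>
    then have "real (Suc k) * \<alpha> \<le> real j * \<alpha>"
      using \<alpha>_pos by (intro mult_right_mono) auto
    with next_gt have "b_seq m p n \<le> a_seq m p j" unfolding a_floor[of j] by linarith
    with that show False by simp
  qed
  ultimately show ?thesis using \<open>varphi m p n = real k\<close> by blast
qed

end
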